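(* Let $K$ be any non-empty set and let $\mathbb{X}$ be a Banach space over $\mathbb{K}\in\{\mathbb{R},\mathbb{C}\}$. Suppose that $f \in \ell_{\infty}(K,\mathbb{X})$ with $\|f\|=1$ is right symmetric in $\ell_{\infty}(K,\mathbb{X})$. Then: (i) $\|f(k)\|=1$ for all $k\in K$; (ii) $f(k)$ is a right symmetric point of $\mathbb{X}$ for all $k\in K$.
   Context: $\ell_{\infty}(K,\mathbb{X})$ is the Banach space of all bounded functions $f:K\to\mathbb{X}$ with norm $\|f\|=\sup_{k\in K}\|f(k)\|$. For a Banach space $\mathbb{Z}$ over $\mathbb{K}$ and $x,y\in\mathbb{Z}$, $x\perp_B y$ (Birkhoff-James orthogonality) means $\|x+\lambda y\|\ge\|x\|$ for all $\lambda\in\mathbb{K}$. A point $x\in\mathbb{Z}$ is right symmetric (in $\mathbb{Z}$) if for all $y\in\mathbb{Z}$, $y\perp_B x$ implies $x\perp_B y$. *)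

theory Defs
  imports "HOL-Analysis.Analysis"
begin

text \<open>
  The class \<open>banach\<close> of the library is that of real Banach spaces. A complex Banach space is
  a real one with a multiplication by complex scalars that extends the real one and for which
  the norm is absolutely homogeneous.
\<close>

class complex_banach = banach +
  fixes scaleC :: "complex \<Rightarrow> 'a \<Rightarrow> 'a"
  assumes scaleC_add_right: "scaleC c (x + y) = scaleC c x + scaleC c y"
    and scaleC_add_left: "scaleC (c + d) x = scaleC c x + scaleC d x"
    and scaleC_scaleC: "scaleC c (scaleC d x) = scaleC (c * d) x"
    and scaleC_of_real: "scaleC (complex_of_real r) x = scaleR r x"
    and norm_scaleC: "norm (scaleC c x) = cmod c * norm x"

instantiation complex :: complex_banach
begin

definition scaleC_complex :: "complex \<Rightarrow> complex \<Rightarrow> complex"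
  where "scaleC_complex c x = c * x"

instance
  by standard (simp_all add: scaleC_complex_def algebra_simps norm_mult scaleR_conv_of_real)

end

text \<open>
  The scalar field \<open>'k\<close> enters through the scalar multiplication \<open>scl\<close>, which is \<open>scaleR\<close>
  for spaces over the reals and \<open>scaleC\<close> for spaces over the complex numbers.
\<close>

definition bj_orthogonal ::
    "('k \<Rightarrow> 'z \<Rightarrow> 'z) \<Rightarrow> 'z::real_normed_vector \<Rightarrow> 'z \<Rightarrow> bool"
  where "bj_orthogonal scl x y \<longleftrightarrow> (\<forall>c. norm (x + scl c y) \<ge> norm x)"

definition right_symmetric :: "('k \<Rightarrow> 'z \<Rightarrow> 'z) \<Rightarrow> 'z::real_normed_vector \<Rightarrow> bool"
  where "right_symmetric scl x \<longleftrightarrow>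
    (\<forall>y. bj_orthogonal scl y x \<longrightarrow> bj_orthogonal scl x y)"

text \<open>
  The non-empty index set is the universe of the type \<open>'i\<close>.
\<close>

typedef (overloaded) ('i, 'x) linf = "{f :: 'i \<Rightarrow> 'x::real_normed_vector. bounded (range f)}"
  morphisms linf_apply Linf
  by (rule exI[of _ "\<lambda>_. 0"]) simp

setup_lifting type_definition_linf

lemma bounded_linf_apply: "bounded (range (linf_apply f))"
  using linf_apply by auto

lemma linf_eqI: "(\<And>k. linf_apply f k = linf_apply g k) \<Longrightarrow> f = g"
  by (simp add: linf_apply_inject[symmetric] fun_eq_iff)

instantiation linf :: (type, real_normed_vector) real_normed_vector
begin

lift_definition zero_linf :: "('a, 'b) linf" is "\<lambda>_. 0" by simp

lift_definition plus_linf :: "('a, 'b) linf \<Rightarrow> ('a, 'b) linf \<Rightarrow> ('a, 'b) linf"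
  is "\<lambda>f g k. f k + g k" by (rule bounded_plus_comp)

lift_definition uminus_linf :: "('a, 'b) linf \<Rightarrow> ('a, 'b) linf"
  is "\<lambda>f k. - f k" by (simp add: bounded_iff)

lift_definition minus_linf :: "('a, 'b) linf \<Rightarrow> ('a, 'b) linf \<Rightarrow> ('a, 'b) linf"
  is "\<lambda>f g k. f k - g k" by (rule bounded_minus_comp)

lift_definition scaleR_linf :: "real \<Rightarrow> ('a, 'b) linf \<Rightarrow> ('a, 'b) linf"
  is "\<lambda>r f k. scaleR r (f k)" by (rule bounded_scaleR_comp)

definition norm_linf :: "('a, 'b) linf \<Rightarrow> real"
  where "norm_linf f = (SUP k. norm (linf_apply f k))"

definition dist_linf :: "('a, 'b) linf \<Rightarrow> ('a, 'b) linf \<Rightarrow> real"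
  where "dist_linf f g = norm (f - g)"

definition sgn_linf :: "('a, 'b) linf \<Rightarrow> ('a, 'b) linf"
  where "sgn_linf f = scaleR (inverse (norm f)) f"

definition uniformity_linf :: "(('a, 'b) linf \<times> ('a, 'b) linf) filter"
  where "uniformity_linf = (INF e\<in>{0 <..}. principal {(x, y). dist x y < e})"

definition open_linf :: "('a, 'b) linf set \<Rightarrow> bool"
  where "open_linf U \<longleftrightarrow> (\<forall>x\<in>U. \<forall>\<^sub>F (x', y) in uniformity. x' = x \<longrightarrow> y \<in> U)"

lemma norm_linf_upper: "norm (linf_apply f k) \<le> norm (f :: ('a, 'b) linf)"
proof -
  have "bdd_above (range (\<lambda>k. norm (linf_apply f k)))"
    using bounded_linf_apply[of f] by (force simp: bounded_iff bdd_above_def)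
  then show ?thesis
    unfolding norm_linf_def by (rule cSUP_upper[OF UNIV_I])
qed

lemma norm_linf_least: "(\<And>k. norm (linf_apply f k) \<le> b) \<Longrightarrow> norm (f :: ('a, 'b) linf) \<le> b"
  unfolding norm_linf_def by (rule cSUP_least) auto

instance
proof
  fix f g h :: "('a, 'b) linf" and r s :: real
  show "f + g + h = f + (g + h)" "f + g = g + f" "0 + f = f" "- f + f = 0" "f - g = f + - g"
    "r *\<^sub>R (f + g) = r *\<^sub>R f + r *\<^sub>R g" "(r + s) *\<^sub>R f = r *\<^sub>R f + s *\<^sub>R f"
    "r *\<^sub>R s *\<^sub>R f = (r * s) *\<^sub>R f" "1 *\<^sub>R f = f"
    by (transfer; simp add: algebra_simps)+
  show "dist f g = norm (f - g)" by (rule dist_linf_def)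
  show "sgn f = inverse (norm f) *\<^sub>R f" by (rule sgn_linf_def)
  show "uniformity = (INF e\<in>{0 <..}. principal {(x, y :: ('a, 'b) linf). dist x y < e})"
    by (rule uniformity_linf_def)
  show "open U \<longleftrightarrow> (\<forall>x\<in>U. \<forall>\<^sub>F (x', y) in uniformity. x' = x \<longrightarrow> y \<in> U)"
    for U :: "('a, 'b) linf set"
    by (rule open_linf_def)
  show "norm f = 0 \<longleftrightarrow> f = 0"
  proof
    assume "norm f = 0"
    then have "linf_apply f k = 0" for k
      using norm_linf_upper[of f k] by simp
    then show "f = 0" by (intro linf_eqI) (simp add: zero_linf.rep_eq)
  qed (simp add: norm_linf_def zero_linf.rep_eq)
  show "norm (f + g) \<le> norm f + norm g"
    by (rule norm_linf_least)
      (auto simp: plus_linf.rep_eq intro!: norm_triangle_le add_mono norm_linf_upper)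
  have le: "norm (r *\<^sub>R f) \<le> \<bar>r\<bar> * norm f" for r and f :: "('a, 'b) linf"
    by (rule norm_linf_least)
      (auto simp: scaleR_linf.rep_eq intro!: mult_left_mono norm_linf_upper)
  show "norm (r *\<^sub>R f) = \<bar>r\<bar> * norm f"
  proof (cases "r = 0")
    case True
    then have "r *\<^sub>R f = 0"
      by (intro linf_eqI) (simp add: scaleR_linf.rep_eq zero_linf.rep_eq)
    with True show ?thesis
      by (simp add: norm_linf_def zero_linf.rep_eq)
  next
    case False
    then have "inverse r *\<^sub>R r *\<^sub>R f = f"
      by (intro linf_eqI) (simp add: scaleR_linf.rep_eq)
    then have "norm f \<le> \<bar>inverse r\<bar> * norm (r *\<^sub>R f)"
      using le[of "inverse r" "r *\<^sub>R f"] by simp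
    then have "\<bar>r\<bar> * norm f \<le> norm (r *\<^sub>R f)"
      using False by (simp add: field_simps)
    with le[of r f] show ?thesis by simp
  qed
qed

end

instance linf :: (type, banach) banach
proof
  fix F :: "nat \<Rightarrow> ('a, 'b) linf"
  assume F: "Cauchy F"
  have conv: "convergent (\<lambda>n. linf_apply (F n) k)" for k
  proof (rule Cauchy_convergent, rule metric_CauchyI)
    fix e :: real
    assume "e > 0"
    then obtain N where N: "\<forall>m\<ge>N. \<forall>n\<ge>N. dist (F m) (F n) < e"
      using metric_CauchyD[OF F] by blast
    have "dist (linf_apply (F m) k) (linf_apply (F n) k) \<le> dist (F m) (F n)" for m n
      using norm_linf_upper[of "F m - F n" k] by (simp add: dist_norm minus_linf.rep_eq)
    with N show "\<exists>M. \<forall>m\<ge>M. \<forall>n\<ge>M. dist (linf_apply (F m) k) (linf_apply (F n) k) < e"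
      by (meson le_less_trans)
  qed
  define l where "l = (\<lambda>k. lim (\<lambda>n. linf_apply (F n) k))"
  have lim: "(\<lambda>n. linf_apply (F n) k) \<longlonglongrightarrow> l k" for k
    using conv[of k] by (simp add: l_def convergent_LIMSEQ_iff)
  have unif: "norm (linf_apply (F m) k - l k) \<le> e"
    if N: "\<forall>m\<ge>N. \<forall>n\<ge>N. dist (F m) (F n) < e" and m: "m \<ge> N" for m N e k
  proof (rule tendsto_upperbound)
    show "(\<lambda>n. norm (linf_apply (F m) k - linf_apply (F n) k)) \<longlonglongrightarrow> norm (linf_apply (F m) k - l k)"
      by (intro tendsto_intros lim)
    have "norm (linf_apply (F m) k - linf_apply (F n) k) \<le> e" if "n \<ge> N" for n
      using norm_linf_upper[of "F m - F n" k] N m that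
      by (fastforce simp: dist_norm minus_linf.rep_eq)
    then show "\<forall>\<^sub>F n in sequentially. norm (linf_apply (F m) k - linf_apply (F n) k) \<le> e"
      by (auto simp: eventually_sequentially)
  qed simp
  obtain N where N: "\<forall>m\<ge>N. \<forall>n\<ge>N. dist (F m) (F n) < 1"
    using metric_CauchyD[OF F, of 1] by auto
  have "norm (l k) \<le> norm (F N) + 1" for k
    using unif[OF N order_refl, of k] norm_linf_upper[of "F N" k]
      norm_triangle_sub[of "l k" "linf_apply (F N) k"] by (simp add: norm_minus_commute)
  then have "bounded (range l)"
    by (auto simp: bounded_iff)
  then have l: "linf_apply (Linf l) = l"
    by (simp add: Linf_inverse)
  have "F \<longlonglongrightarrow> Linf l"
  proof (rule metric_LIMSEQ_I)
    fix e :: real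
    assume "e > 0"
    then obtain N where N: "\<forall>m\<ge>N. \<forall>n\<ge>N. dist (F m) (F n) < e / 2"
      using metric_CauchyD[OF F, of "e / 2"] by auto
    have "dist (F m) (Linf l) \<le> e / 2" if "m \<ge> N" for m
      unfolding dist_norm
      by (rule norm_linf_least) (simp only: minus_linf.rep_eq l unif[OF N that])
    with \<open>e > 0\<close> show "\<exists>N. \<forall>m\<ge>N. dist (F m) (Linf l) < e"
      by (intro exI[of _ N]) (force intro: le_less_trans)
  qed
  then show "convergent F" by (rule convergentI)
qed

instantiation linf :: (type, complex_banach) complex_banach
begin

lift_definition scaleC_linf :: "complex \<Rightarrow> ('a, 'b) linf \<Rightarrow> ('a, 'b) linf"
  is "\<lambda>c f k. scaleC c (f k)"
proof -
  fix c :: complex and f :: "'a \<Rightarrow> 'b"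
  assume "bounded (range f)"
  then obtain B where "\<And>k. norm (f k) \<le> B"
    by (auto simp: bounded_iff)
  then have "norm (scaleC c (f k)) \<le> cmod c * B" for k
    by (simp add: norm_scaleC mult_left_mono)
  then show "bounded (range (\<lambda>k. scaleC c (f k)))"
    by (auto simp: bounded_iff)
qed

instance
proof
  fix f g :: "('a, 'b) linf" and c d :: complex and r :: real
  show "scaleC c (f + g) = scaleC c f + scaleC c g"
    by (transfer; simp add: scaleC_add_right)
  show "scaleC (c + d) f = scaleC c f + scaleC d f"
    by (transfer; simp add: scaleC_add_left)
  show assoc: "scaleC c (scaleC d f) = scaleC (c * d) f" for c d
    by (transfer; simp add: scaleC_scaleC)
  show of_real: "scaleC (complex_of_real r) f = r *\<^sub>R f" for r
    by (transfer; simp add: scaleC_of_real)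
  have le: "norm (scaleC c f) \<le> cmod c * norm f" for c and f :: "('a, 'b) linf"
    by (rule norm_linf_least)
      (auto simp: scaleC_linf.rep_eq norm_scaleC intro!: mult_left_mono norm_linf_upper)
  show "norm (scaleC c f) = cmod c * norm f"
  proof (cases "c = 0")
    case True
    then show ?thesis using of_real[of 0] by simp
  next
    case False
    then have "scaleC (inverse c) (scaleC c f) = f"
      using of_real[of 1] by (simp add: assoc)
    then have "norm f \<le> cmod (inverse c) * norm (scaleC c f)"
      using le[of "inverse c" "scaleC c f"] by simp
    then have "cmod c * norm f \<le> norm (scaleC c f)"
      using False by (simp add: norm_inverse norm_divide field_simps)
    with le[of c f] show ?thesis by simp
  qed
qed

end

end

theory Submission imports Defs begin

text \<open>
  Both parts test right symmetry of \<open>f\<close> against functions that agree with a scalar multiple of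
  \<open>f\<close> outside a single point \<open>k\<^sub>0\<close>.

  If \<open>a = \<parallel>f(k\<^sub>0)\<parallel> < 1\<close>, write \<open>f(k\<^sub>0) = a u\<close> with a unit vector \<open>u\<close> and let \<open>g\<close> be \<open>f\<close> with the
  value at \<open>k\<^sub>0\<close> replaced by \<open>-u\<close>. Since \<open>1\<close> is a convex combination of \<open>1 + \<lambda>\<close> and \<open>1 - a \<lambda>\<close>,
  one of these has modulus at least \<open>1\<close>, which gives \<open>g \<bottom> f\<close>; but \<open>f - t g\<close> has norm less
  than \<open>1\<close> for small \<open>t > 0\<close>.

  If all values of \<open>f\<close> are unit vectors, \<open>y \<bottom> f(k\<^sub>0)\<close> and \<open>\<parallel>f(k\<^sub>0) + \<mu> y\<parallel> < 1\<close>, let \<open>g\<close> be \<open>y\<close> at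
  \<open>k\<^sub>0\<close> and \<open>s f\<close> elsewhere, where \<open>|s| = \<parallel>y\<parallel>\<close> and \<open>\<mu> s = - |\<mu>| \<parallel>y\<parallel>\<close>. Then \<open>g \<bottom> f\<close>, while
  \<open>0 < |\<mu>| \<parallel>y\<parallel> < 2\<close> forces \<open>\<parallel>f + \<mu> g\<parallel> < 1\<close>.
\<close>

lift_definition linf_upd ::
    "('i, 'x::real_normed_vector) linf \<Rightarrow> 'i \<Rightarrow> 'x \<Rightarrow> ('i, 'x) linf"
  is "\<lambda>f k y. f(k := y)"
proof -
  fix f :: "'i \<Rightarrow> 'x" and k y
  assume "bounded (range f)"
  then have "bounded (insert y (range f))" by simp
  then show "bounded (range (f(k := y)))"
    by (rule bounded_subset) auto
qed

lemma norm_one_plus_or_one_minus: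
  fixes c :: "'a::real_normed_algebra_1"
  assumes "a \<ge> 0"
  shows "norm (1 + c) \<ge> 1 \<or> norm (1 - a *\<^sub>R c) \<ge> 1"
proof (rule ccontr)
  assume *: "\<not> ?thesis"
  have "1 + a = norm ((1 + a) *\<^sub>R (1::'a))" using assms by simp
  also have "(1 + a) *\<^sub>R (1::'a) = a *\<^sub>R (1 + c) + (1 - a *\<^sub>R c)"
    by (simp add: algebra_simps)
  also have "norm \<dots> \<le> a * norm (1 + c) + norm (1 - a *\<^sub>R c)"
    using norm_triangle_ineq[of "a *\<^sub>R (1 + c)" "1 - a *\<^sub>R c"] assms by simp
  also have "\<dots> < a * 1 + 1"
    using * assms by (intro add_le_less_mono mult_left_mono) auto
  finally show False by simp
qed

text \<open>
  Covers real and complex scalars at once: \<open>scl\<close> acts on the value space, \<open>scl_linf\<close> on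
  the function space.
\<close>

locale linf_scalars =
  fixes scl :: "'k::real_normed_field \<Rightarrow> 'x::real_normed_vector \<Rightarrow> 'x"
    and scl_linf :: "'k \<Rightarrow> ('i, 'x) linf \<Rightarrow> ('i, 'x) linf"
  assumes scl_add_left: "scl (c + d) x = scl c x + scl d x"
    and scl_scl: "scl c (scl d x) = scl (c * d) x"
    and scl_of_real: "scl (of_real r) x = r *\<^sub>R x"
    and norm_scl: "norm (scl c x) = norm c * norm x"
    and linf_apply_scl: "linf_apply (scl_linf c f) k = scl c (linf_apply f k)"
begin

lemma scl_one [simp]: "scl 1 x = x"
  using scl_of_real[of 1 x] by simp

lemma apply_upd_scl:
  "linf_apply (linf_upd (scl_linf t f) k y) j = (if j = k then y else scl t (linf_apply f j))"
  by (simp add: linf_upd.rep_eq linf_apply_scl)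

lemma norm_upd_scl_le:
  "norm (linf_upd (scl_linf t f) k y) \<le> max (norm y) (norm t * norm f)"
proof (rule norm_linf_least)
  fix j
  show "norm (linf_apply (linf_upd (scl_linf t f) k y) j) \<le> max (norm y) (norm t * norm f)"
    using mult_left_mono[OF norm_linf_upper[of f j], of "norm t"]
    by (simp add: apply_upd_scl norm_scl le_max_iff_disj)
qed

text \<open>Away from \<open>k\<close> the sum is \<open>f\<close> times the scalar
  \<open>1 + c * t\<close>. When \<open>norm f = 1\<close>, making both terms of the maximum less
  than 1 refutes orthogonality of \<open>f\<close> to the test function.\<close>

lemma norm_add_upd_scl_le:
  "norm (f + scl_linf c (linf_upd (scl_linf t f) k y))
    \<le> max (norm (linf_apply f k + scl c y)) (norm (1 + c * t) * norm f)"
proof (rule norm_linf_least)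
  fix j
  have "x + scl c (scl t x) = scl (1 + c * t) x" for x
    by (simp add: scl_add_left scl_scl)
  then show "norm (linf_apply (f + scl_linf c (linf_upd (scl_linf t f) k y)) j)
    \<le> max (norm (linf_apply f k + scl c y)) (norm (1 + c * t) * norm f)"
    using mult_left_mono[OF norm_linf_upper[of f j], of "norm (1 + c * t)"]
    by (simp add: plus_linf.rep_eq linf_apply_scl apply_upd_scl norm_scl le_max_iff_disj)
qed

lemma right_symmetric_imp_norm_apply_ge:
  assumes norm1: "norm f = 1" and rs: "right_symmetric scl_linf f"
  shows "norm (linf_apply f k\<^sub>0) \<ge> 1"
proof (rule ccontr)
  define a where "a = norm (linf_apply f k\<^sub>0)"
  assume "\<not> ?thesis"
  then have a: "0 \<le> a" "a < 1" by (auto simp: a_def)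
  \<comment> \<open>Supplies a direction for \<open>u\<close> in case \<open>f\<close> vanishes at
    \<open>k\<^sub>0\<close>.\<close>
  obtain v :: 'x where v: "norm v = 1"
  proof -
    obtain k where "linf_apply f k \<noteq> 0"
      using norm_linf_least[of f 0] norm1 by fastforce
    then show ?thesis by (intro that[of "sgn (linf_apply f k)"]) (simp add: norm_sgn)
  qed
  obtain u where u: "norm u = 1" "linf_apply f k\<^sub>0 = a *\<^sub>R u"
  proof (cases "a = 0")
    case True
    then show ?thesis using that[of v] v by (simp add: a_def)
  next
    case False
    then show ?thesis
      by (intro that[of "sgn (linf_apply f k\<^sub>0)"]) (auto simp: a_def norm_sgn sgn_div_norm)
  qed
  \<comment> \<open>The factor 1 brings \<open>g\<close> into the form of the two norm bounds
    above.\<close>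
  define g where "g = linf_upd (scl_linf 1 f) k\<^sub>0 (- u)"
  have "norm g \<le> 1"
    using norm_upd_scl_le[of 1 f k\<^sub>0 "- u"] u norm1 by (simp add: g_def)
  moreover have "norm (g + scl_linf c f) \<ge> 1" for c
  proof -
    have up: "norm (linf_apply (g + scl_linf c f) k) \<le> norm (g + scl_linf c f)" for k
      by (rule norm_linf_upper)
    from norm_one_plus_or_one_minus[OF a(1), of c] show ?thesis
    proof
      assume c: "norm (1 + c) \<ge> 1"
      \<comment> \<open>The term \<open>a\<close> absorbs the point \<open>k\<^sub>0\<close>; as
        \<open>a < 1 = norm f\<close>, the supremum is governed by the other points.\<close>
      have "norm (linf_apply f k) \<le> max a (norm (g + scl_linf c f))" for k
      proof (cases "k = k\<^sub>0")
        case False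
        have "linf_apply (g + scl_linf c f) k = scl (1 + c) (linf_apply f k)"
          using False by (simp add: g_def plus_linf.rep_eq apply_upd_scl linf_apply_scl scl_add_left)
        then have "norm (1 + c) * norm (linf_apply f k) \<le> norm (g + scl_linf c f)"
          using up[of k] by (simp add: norm_scl)
        then show ?thesis
          using mult_right_mono[OF c norm_ge_zero[of "linf_apply f k"]] by simp
      qed (simp add: a_def)
      then have "norm f \<le> max a (norm (g + scl_linf c f))"
        by (rule norm_linf_least)
      with norm1 a show ?thesis by simp
    next
      assume c: "norm (1 - a *\<^sub>R c) \<ge> 1"
      have "- u + scl c (a *\<^sub>R u) = scl (of_real (- 1) + c * of_real a) u"
        unfolding scl_add_left scl_scl[symmetric] scl_of_real by simp
      also have "of_real (- 1) + c * of_real a = - (1 - a *\<^sub>R c)"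
        by (simp add: scaleR_conv_of_real)
      finally have "linf_apply (g + scl_linf c f) k\<^sub>0 = scl (- (1 - a *\<^sub>R c)) u"
        by (simp add: g_def plus_linf.rep_eq apply_upd_scl linf_apply_scl u(2))
      then show ?thesis
        using up[of k\<^sub>0] c u(1) by (simp only: norm_scl norm_minus_cancel mult_1_right)
    qed
  qed
  ultimately have "bj_orthogonal scl_linf g f"
    unfolding bj_orthogonal_def by (meson order_trans)
  with rs have orth: "norm f \<le> norm (f + scl_linf c g)" for c
    by (simp add: right_symmetric_def bj_orthogonal_def)
  \<comment> \<open>Then \<open>a + t = (1 + a) / 2 < 1\<close> at \<open>k\<^sub>0\<close>, and the
    factor \<open>1 - t\<close> elsewhere is also below 1.\<close>
  define t where "t = (1 - a) / 2"
  have "linf_apply f k\<^sub>0 + scl (of_real (- t)) (- u) = (a + t) *\<^sub>R u"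
    unfolding scl_of_real u(2) by (simp add: algebra_simps)
  then have *: "norm (linf_apply f k\<^sub>0 + scl (of_real (- t)) (- u)) < 1"
    using a u(1) by (simp add: t_def field_simps)
  have eq: "1 + of_real (- t) * 1 = (of_real (1 - t) :: 'k)" by simp
  have "norm (1 + of_real (- t) * 1 :: 'k) < 1"
    using a unfolding eq norm_of_real by (simp add: t_def field_simps)
  with * show False
    using orth[of "of_real (- t)"] norm_add_upd_scl_le[of f "of_real (- t)" 1 k\<^sub>0 "- u"] norm1
    by (simp add: g_def)
qed

lemma right_symmetric_imp_right_symmetric_apply:
  assumes norm1: "norm f = 1" and rs: "right_symmetric scl_linf f"
  shows "right_symmetric scl (linf_apply f k\<^sub>0)"
  unfolding right_symmetric_def
proof (intro allI impI)
  fix y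
  define x where "x = linf_apply f k\<^sub>0"
  assume "bj_orthogonal scl y (linf_apply f k\<^sub>0)"
  then have y: "norm y \<le> norm (y + scl c x)" for c
    by (simp add: bj_orthogonal_def x_def)
  have x: "norm x = 1"
    using right_symmetric_imp_norm_apply_ge[OF norm1 rs, of k\<^sub>0] norm_linf_upper[of f k\<^sub>0] norm1
    by (simp add: x_def)
  have "norm x \<le> norm (x + scl \<mu> y)" for \<mu>
  proof (rule ccontr)
    assume "\<not> ?thesis"
    then have less: "norm (x + scl \<mu> y) < 1" using x by simp
    define r where "r = norm \<mu> * norm y"
    have "r \<noteq> 0"
    proof
      assume "r = 0"
      then have "norm (scl \<mu> y) = 0" unfolding norm_scl r_def .
      then have "scl \<mu> y = 0" by simp
      with less x show False by simp
    qed
    then have r0: "r > 0" and \<mu>: "\<mu> \<noteq> 0" by (auto simp: r_def)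
    \<comment> \<open>\<open>r\<close> is the norm of \<open>scl \<mu> y\<close>, the difference of
      a vector of norm below 1 and the unit vector \<open>x\<close>.\<close>
    have r2: "r < 2"
      using norm_triangle_ineq4[of "x + scl \<mu> y" x] less x by (simp add: norm_scl r_def)
    define s where "s = - of_real (norm y) * inverse (sgn \<mu>)"
    have "norm s = norm y"
      using \<mu> by (simp add: s_def norm_mult norm_inverse norm_sgn)
    have \<mu>s: "\<mu> * s = - of_real r"
      using \<mu> by (simp add: s_def r_def sgn_div_norm scaleR_conv_of_real)
    define g where "g = linf_upd (scl_linf s f) k\<^sub>0 y"
    have "norm g \<le> norm y"
      using norm_upd_scl_le[of s f k\<^sub>0 y] norm1 \<open>norm s = norm y\<close> by (simp add: g_def)
    \<comment> \<open>The value at \<open>k\<^sub>0\<close> alone suffices: there the sum is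
      \<open>y + scl c x\<close>.\<close>
    moreover have "norm y \<le> norm (g + scl_linf c f)" for c
      using y[of c] norm_linf_upper[of "g + scl_linf c f" k\<^sub>0]
      by (simp add: g_def x_def plus_linf.rep_eq apply_upd_scl linf_apply_scl)
    ultimately have "bj_orthogonal scl_linf g f"
      unfolding bj_orthogonal_def by (meson order_trans)
    with rs have "norm f \<le> norm (f + scl_linf \<mu> g)"
      by (simp add: right_symmetric_def bj_orthogonal_def)
    moreover have "1 + \<mu> * s = of_real (1 - r)" by (simp add: \<mu>s)
    then have "norm (1 + \<mu> * s) < 1"
      using r0 r2 by (simp only: norm_of_real)
    ultimately show False
      using norm_add_upd_scl_le[of f \<mu> s k\<^sub>0 y] norm1 less by (simp add: g_def x_def)
  qed
  then show "bj_orthogonal scl (linf_apply f k\<^sub>0) y"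
    by (simp add: bj_orthogonal_def x_def)
qed

lemma right_symmetric_linf:
  assumes "norm f = 1" and "right_symmetric scl_linf f"
  shows "(\<forall>k. norm (linf_apply f k) = 1) \<and> (\<forall>k. right_symmetric scl (linf_apply f k))"
  using right_symmetric_imp_norm_apply_ge[OF assms]
    right_symmetric_imp_right_symmetric_apply[OF assms] norm_linf_upper[of f] assms(1)
  by (metis order_antisym)

end

interpretation real_scalars: linf_scalars scaleR scaleR
  by standard (simp_all add: scaleR_add_left scaleR_linf.rep_eq)

interpretation complex_scalars: linf_scalars scaleC scaleC
  by standard (simp_all add: scaleC_add_left scaleC_scaleC scaleC_of_real norm_scaleC
      scaleC_linf.rep_eq)

theorem theorem3p4:
  fixes f :: "('i, 'x::banach) linf"
    and g :: "('j, 'y::complex_banach) linf"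
  shows
    "(norm f = 1 \<and> right_symmetric scaleR f \<longrightarrow>
        (\<forall>k. norm (linf_apply f k) = 1) \<and>
        (\<forall>k. right_symmetric scaleR (linf_apply f k))) \<and>
     (norm g = 1 \<and> right_symmetric scaleC g \<longrightarrow>
        (\<forall>k. norm (linf_apply g k) = 1) \<and>
        (\<forall>k. right_symmetric scaleC (linf_apply g k)))"
  using real_scalars.right_symmetric_linf[of f] complex_scalars.right_symmetric_linf[of g]
  by blast

end
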